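(* Let $\mathcal{G}_c$ be the class of connected graphs and let $k\geq 3$ be an integer. Then $$d_k(\mathcal{G}_c)\leq \frac{k^3-4k^2+5k-2}{6k^2-8k}.$$
   Context: All graphs are finite and simple. For a connected graph $G$, $\ell(G)$ is the length (number of edges) of a longest path in $G$, and $\mathcal{L}(G)$ is the set of all longest paths of $G$, i.e. all paths $P$ in $G$ with $|V(P)|=\ell(G)+1$ (a path is regarded as a subgraph). $d_G(x,y)$ is the usual graph distance, and for $U\subseteq V(G)$, $d_G(x,U)=\min\{d_G(x,y) : y\in U\}$. For $\mathcal{P}\subseteq\mathcal{L}(G)$, the path-distance-function is $$f(G,\mathcal{P})=\min\Big\{\sum_{P\in\mathcal{P}} d_G(v,V(P)) : v\in V(G)\Big\}.$$ For a class of graphs $\mathcal{G}$ and an integer $k$, the path-distance-ratio is $$d_k(\mathcal{G})=\sup \frac{f(G,\mathcal{P})}{|V(G)|},$$ where the supremum is over all graphs $G\in\mathcal{G}$ and all sets $\mathcal{P}\subseteq\mathcal{L}(G)$ with $|\mathcal{P}|=k$. *)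

theory Defs
  imports
    "Graph_Theory.Pair_Digraph"
    "Graph_Theory.Digraph_Component"
    "Graph_Theory.Shortest_Path"
    "HOL-Library.Extended_Real"
begin

text \<open>
  A finite simple graph is a \<open>pair_graph\<close>: a finite loop-free symmetric set of vertex pairs, so that
  every undirected edge occurs as two opposite arcs. The library predicate \<open>connected\<close> includes that
  the vertex set is nonempty. It is written with its qualified name because of the topological
  notion of the same name.
\<close>

definition connected_graphs :: "'a pair_pre_digraph set" where
  "connected_graphs = {G. pair_graph G \<and> Digraph_Component.connected (with_proj G)}"

abbreviation graph_apath :: "'a pair_pre_digraph \<Rightarrow> 'a \<Rightarrow> ('a \<times> 'a) list \<Rightarrow> 'a \<Rightarrow> bool" where
  "graph_apath G \<equiv> pre_digraph.apath (with_proj G)"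

definition graph_dist :: "'a pair_pre_digraph \<Rightarrow> 'a \<Rightarrow> 'a \<Rightarrow> nat" where
  "graph_dist G x y = (LEAST n. \<exists>p. graph_apath G x p y \<and> length p = n)"

definition graph_dist_set :: "'a pair_pre_digraph \<Rightarrow> 'a \<Rightarrow> 'a set \<Rightarrow> nat" where
  "graph_dist_set G x U = Min {graph_dist G x y | y. y \<in> U}"

definition longest_path_length :: "'a pair_pre_digraph \<Rightarrow> nat" where
  "longest_path_length G = Max {length p | u p v. graph_apath G u p v}"

text \<open>
  The subgraph traced by an arc sequence. Both orientations of every edge are included, so that
  traversing a path in the two directions gives the same subgraph.
\<close>

definition path_subgraph :: "'a \<Rightarrow> ('a \<times> 'a) list \<Rightarrow> 'a pair_pre_digraph" where
  "path_subgraph u p = \<lparr> pverts = set (pawalk_verts u p), parcs = set p \<union> (set p)\<inverse> \<rparr>"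

definition graph_paths :: "'a pair_pre_digraph \<Rightarrow> 'a pair_pre_digraph set" where
  "graph_paths G = {path_subgraph u p | u p v. graph_apath G u p v}"

definition longest_paths :: "'a pair_pre_digraph \<Rightarrow> 'a pair_pre_digraph set" where
  "longest_paths G = {P \<in> graph_paths G. card (pverts P) = longest_path_length G + 1}"

definition path_distance :: "'a pair_pre_digraph \<Rightarrow> 'a pair_pre_digraph set \<Rightarrow> nat" where
  "path_distance G Ps = Min {\<Sum>P\<in>Ps. graph_dist_set G v (pverts P) | v. v \<in> pverts G}"

text \<open>
  The supremum is taken in the extended reals, where it is meaningful without a priori knowledge of
  boundedness: an upper bound on it is an upper bound on every single ratio.
\<close>

definition path_distance_ratio :: "nat \<Rightarrow> 'a pair_pre_digraph set \<Rightarrow> ereal" where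
  "path_distance_ratio k \<G> =
    Sup {ereal (real (path_distance G Ps) / real (card (pverts G))) | G Ps.
      G \<in> \<G> \<and> Ps \<subseteq> longest_paths G \<and> card Ps = k}"

text \<open>
  On connected graphs, \<open>graph_dist\<close> is the weighted distance of the library for unit weights.
\<close>

lemma graph_dist_eq_mu:
  assumes "G \<in> connected_graphs" "x \<in> pverts G" "y \<in> pverts G"
  shows "ereal (real (graph_dist G x y)) = wf_digraph.\<mu> (with_proj G) (\<lambda>_. 1) x y"
proof -
  from assms(1) have pg: "pair_graph G" and con: "Digraph_Component.connected (with_proj G)"
    by (auto simp: connected_graphs_def)
  interpret D: graph "with_proj G" using pg by (rule pair_graph.pair_graphD_graph)
  have cost: "D.awalk_cost (\<lambda>_. 1) p = real (length p)" for p
    by (induct p) auto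
  have "strongly_connected (with_proj G)"
    using con D.symmetric_connected_imp_strongly_connected D.sym_arcs by blast
  then have "x \<rightarrow>\<^sup>*\<^bsub>with_proj G\<^esub> y"
    using assms(2,3) by (auto simp: strongly_connected_def)
  then obtain p where p: "D.apath x p y" and mu: "D.\<mu> (\<lambda>_. 1) x y = D.awalk_cost (\<lambda>_. 1) p"
    using D.min_cost_awalk[of x y "\<lambda>_. 1"] by auto
  have "graph_dist G x y = length p"
    unfolding graph_dist_def
  proof (rule Least_equality)
    show "\<exists>q. D.apath x q y \<and> length q = length p" using p by blast
  next
    fix n assume "\<exists>q. D.apath x q y \<and> length q = n"
    then obtain q where q: "D.awalk x q y" "length q = n" by (auto simp: D.apath_def)
    have "D.\<mu> (\<lambda>_. 1) x y \<le> D.awalk_cost (\<lambda>_. 1) q" using q(1) by (rule D.min_cost_le_walk_cost)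
    then show "length p \<le> n" using mu q(2) by (simp add: cost)
  qed
  then show ?thesis using mu by (simp add: cost)
qed

end

theory Submission
  imports Defs
begin

text \<open>
  Write \<open>L\<close> for the number of vertices of a longest path, \<open>n = |V(G)|\<close>, and \<open>f\<close> for the minimum in
  question. Let \<open>P\<close> be a longest path. For every other longest path \<open>Q\<close>, each tail of \<open>P\<close> outside
  \<open>Q\<close> is at most half of \<open>P\<close> (else it would extend half of \<open>Q\<close>), so the middle of \<open>P\<close> lies between
  the first and the last vertex of \<open>P\<close> on \<open>Q\<close>; and by rerouting \<open>Q\<close>, an inner segment of \<open>P\<close>
  avoiding \<open>Q\<close> has at most \<open>(L - 2) / 3\<close> vertices. Walk along \<open>P\<close> from its middle to the first
  vertex \<open>v\<close> that lies on another chosen path. Two of the paths contain \<open>v\<close>, and for all others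
  \<open>v\<close> is still between two vertices of \<open>Q\<close>, hence \<open>f \<le> (k - 2) (L + 1) / 6\<close>.

  If \<open>f > 0\<close>, no vertex is common to all \<open>k\<close> paths, so \<open>k L \<le> (k - 1) n\<close>. Together these bounds
  suffice if \<open>L \<ge> 3 k - 4\<close> or \<open>n \<ge> L + 3\<close>. In the remaining case at most two vertices lie outside
  any given longest path, and averaging the distance sum over all vertices suffices.
\<close>

section \<open>Paths as vertex lists\<close>

locale connected_pair_graph = pair_graph +
  assumes connected_graph: "Digraph_Component.connected (with_proj G)"
begin

text \<open>Vertex lists instead of arc lists turn cutting, reversing and rerouting a path into list
  operations.\<close>

definition simple_path :: "'a list \<Rightarrow> bool" where
  "simple_path xs \<longleftrightarrow> xs \<noteq> [] \<and> distinct xs \<and> set xs \<subseteq> pverts G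
    \<and> successively (\<lambda>x y. (x, y) \<in> parcs G) xs"

definition longest :: "'a list \<Rightarrow> bool" where
  "longest xs \<longleftrightarrow> simple_path xs \<and> length xs = longest_path_length G + 1"

lemma simple_path_rev [simp]: "simple_path (rev xs) \<longleftrightarrow> simple_path xs"
proof -
  have "successively (\<lambda>x y. (y, x) \<in> parcs G) xs \<longleftrightarrow> successively (\<lambda>x y. (x, y) \<in> parcs G) xs"
    by (intro successively_cong) (auto intro: arcs_symmetric)
  then show ?thesis
    by (simp add: simple_path_def)
qed

lemma longest_rev [simp]: "longest (rev xs) \<longleftrightarrow> longest xs"
  by (simp add: longest_def)

lemma apath_imp_simple_path:
  assumes "apath u p v"
  shows "simple_path (pawalk_verts u p)" "hd (pawalk_verts u p) = u"
    "last (pawalk_verts u p) = v" "length (pawalk_verts u p) = Suc (length p)"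
proof -
  have "simple_path (pawalk_verts u p) \<and> hd (pawalk_verts u p) = u
    \<and> last (pawalk_verts u p) = v \<and> length (pawalk_verts u p) = Suc (length p)"
    using assms
  proof (induction p arbitrary: u)
    case Nil
    then show ?case by (auto simp: apath_Nil_iff simple_path_def)
  next
    case (Cons e p)
    then have e: "e \<in> parcs G" "fst e = u" "apath (snd e) p v" "u \<notin> set (pawalk_verts (snd e) p)"
      by (auto simp: apath_Cons_iff)
    have "u \<in> pverts G" "(u, snd e) \<in> parcs G"
      using e(1,2) arc_fst_in_verts by (auto simp: prod_eq_iff)
    moreover have "pawalk_verts (snd e) p \<noteq> []" by (cases p) auto
    ultimately show ?case
      using Cons.IH[OF e(3)] e
      by (auto simp: simple_path_def successively_Cons)
  qed
  then show "simple_path (pawalk_verts u p)" "hd (pawalk_verts u p) = u"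
    "last (pawalk_verts u p) = v" "length (pawalk_verts u p) = Suc (length p)" by auto
qed

lemma simple_path_imp_apath:
  assumes "simple_path xs"
  shows "\<exists>p. apath (hd xs) p (last xs) \<and> pawalk_verts (hd xs) p = xs"
  using assms
proof (induction xs)
  case Nil
  then show ?case by (simp add: simple_path_def)
next
  case (Cons x xs)
  show ?case
  proof (cases "xs = []")
    case True
    then show ?thesis using Cons.prems
      by (intro exI[of _ "[]"]) (auto simp: apath_Nil_iff simple_path_def)
  next
    case False
    then have xs: "simple_path xs" "(x, hd xs) \<in> parcs G" "x \<notin> set xs"
      using Cons.prems by (auto simp: simple_path_def successively_Cons)
    then obtain p where "apath (hd xs) p (last xs)" "pawalk_verts (hd xs) p = xs"
      using Cons.IH by blast
    with xs False show ?thesis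
      by (intro exI[of _ "(x, hd xs) # p"]) (auto simp: apath_Cons_iff)
  qed
qed

text \<open>The inequality is strict because \<open>length\<close> counts vertices, one more than
  the arcs.\<close>

lemma graph_dist_less_length:
  assumes "simple_path xs"
  shows "graph_dist G (hd xs) (last xs) < length xs"
proof -
  obtain p where p: "apath (hd xs) p (last xs)" "pawalk_verts (hd xs) p = xs"
    using simple_path_imp_apath[OF assms] by blast
  then have "graph_dist G (hd xs) (last xs) \<le> length p"
    unfolding graph_dist_def by (intro Least_le) auto
  then show ?thesis using apath_imp_simple_path(4)[OF p(1)] p(2) by simp
qed

lemma graph_dist_set_less_length:
  assumes "simple_path xs" "last xs \<in> U" "finite U"
  shows "graph_dist_set G (hd xs) U < length xs"
proof -
  have "graph_dist_set G (hd xs) U \<le> graph_dist G (hd xs) (last xs)"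
    unfolding graph_dist_set_def using assms(2,3) by (intro Min_le) auto
  then show ?thesis using graph_dist_less_length[OF assms(1)] by linarith
qed

lemma graph_dist_set_eq_0:
  assumes "v \<in> U" "finite U" "v \<in> pverts G"
  shows "graph_dist_set G v U = 0"
  using graph_dist_set_less_length[of "[v]" U] assms by (simp add: simple_path_def)

lemma length_le_longest:
  assumes "simple_path xs"
  shows "length xs \<le> longest_path_length G + 1"
proof -
  obtain p where p: "apath (hd xs) p (last xs)" "pawalk_verts (hd xs) p = xs"
    using simple_path_imp_apath[OF assms] by blast
  \<comment> \<open>\<open>Max\<close> gives an upper bound only on a finite set of lengths;
    distinctness of the vertices supplies the finiteness.\<close>
  have "length q \<le> card (pverts G)" if "apath u q v" for u q v
  proof -
    have "card (set (pawalk_verts u q)) = Suc (length q)" "set (pawalk_verts u q) \<subseteq> pverts G"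
      using apath_imp_simple_path[OF that] by (auto simp: simple_path_def distinct_card)
    then show ?thesis using card_mono[OF pair_finite_verts, of "set (pawalk_verts u q)"] by simp
  qed
  then have "{length p | u p v. apath u p v} \<subseteq> {..card (pverts G)}"
    by auto
  then have "finite {length p | u p v. apath u p v}"
    by (rule finite_subset) simp
  then have "length p \<le> longest_path_length G"
    unfolding longest_path_length_def using p(1) by (intro Max_ge) auto
  then show ?thesis using apath_imp_simple_path(4)[OF p(1)] p(2) by simp
qed

text \<open>The distances see only the vertex set of a path, so a list with the same vertices can
  stand for the subgraph.\<close>

lemma longest_pathsE:
  assumes "P \<in> longest_paths G"
  obtains xs where "longest xs" "set xs = pverts P"
proof -
  obtain u p v where *: "apath u p v" "P = path_subgraph u p"
    "card (pverts P) = longest_path_length G + 1"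
    using assms by (auto simp: longest_paths_def graph_paths_def)
  have "simple_path (pawalk_verts u p)" using apath_imp_simple_path(1)[OF *(1)] .
  moreover from this have "card (set (pawalk_verts u p)) = length (pawalk_verts u p)"
    by (auto simp: simple_path_def distinct_card)
  ultimately show thesis
    using * by (intro that[of "pawalk_verts u p"]) (auto simp: longest_def path_subgraph_def)
qed

lemma simple_path_exists:
  assumes "x \<in> pverts G" "y \<in> pverts G"
  obtains xs where "simple_path xs" "hd xs = x" "last xs = y"
proof -
  have "strongly_connected (with_proj G)"
    using connected_graph symmetric_connected_imp_strongly_connected sym_arcs by blast
  then have "x \<rightarrow>\<^sup>*\<^bsub>with_proj G\<^esub> y"
    using assms by (auto simp: strongly_connected_def)
  then obtain p where p: "apath x p y"
    by (auto simp: reachable_apath)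
  show thesis using that apath_imp_simple_path[OF p] by blast
qed

section \<open>Gluing paths; any two longest paths intersect\<close>

lemma simple_path_append:
  assumes "xs \<noteq> []" "ys \<noteq> []"
  shows "simple_path (xs @ ys) \<longleftrightarrow> simple_path xs \<and> simple_path ys \<and> set xs \<inter> set ys = {}
    \<and> (last xs, hd ys) \<in> parcs G"
  using assms by (auto simp: simple_path_def successively_append_iff)

lemma simple_path_infix:
  assumes "simple_path (xs @ ys @ zs)" "ys \<noteq> []"
  shows "simple_path ys"
  using assms by (auto simp: simple_path_def successively_append_iff)

text \<open>The gluing step of \<open>longest_inter\<close> and \<open>longest_gap\<close>: a detour
  from \<open>p\<close> to \<open>q\<close> whose inner vertices \<open>M\<close> avoid both outer
  pieces.\<close>

lemma simple_path_splice:
  assumes "simple_path (A @ [p])" "simple_path (p # M @ [q])" "simple_path (q # C)"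
    "set (A @ [p]) \<inter> set (q # C) = {}" "set M \<inter> set (A @ q # C) = {}"
  shows "simple_path (A @ p # M @ q # C)"
  using assms by (auto simp: simple_path_def successively_append_iff successively_Cons hd_append)

text \<open>Cut \<open>ys\<close> at \<open>q\<close> into \<open>C @ q # D\<close>. Following
  \<open>T\<close> to \<open>q\<close> and then either side of \<open>ys\<close> gives two paths,
  and adding their two length bounds yields the claim.\<close>

lemma longest_tail:
  assumes P: "longest (T @ q # B)" and Q: "longest ys" "q \<in> set ys" "set T \<inter> set ys = {}"
  shows "2 * length T \<le> longest_path_length G"
proof (cases "T = []")
  case False
  obtain C D where ys: "ys = C @ q # D" using Q(2) by (auto simp: in_set_conv_decomp)
  have T: "simple_path T" "(last T, q) \<in> parcs G" "q \<notin> set T"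
    using P False by (auto simp: longest_def simple_path_append)
  have C: "simple_path (rev (C @ [q]))" and D: "simple_path (q # D)"
    using Q(1) unfolding simple_path_rev ys
    by (auto simp: longest_def simple_path_def successively_append_iff successively_Cons)
  have "simple_path (T @ rev (C @ [q]))" "simple_path (T @ q # D)"
    using T C D Q(3) False by (subst simple_path_append; auto simp: ys)+
  from this[THEN length_le_longest] show ?thesis
    using Q(1) by (simp add: ys longest_def)
qed simp

text \<open>If two longest paths were disjoint, a shortcut between them would join the longer piece
  of each, giving at least \<open>longest_path_length G + 2\<close> vertices.\<close>

lemma longest_inter:
  assumes P: "longest xs" and Q: "longest ys"
  shows "set xs \<inter> set ys \<noteq> {}"
proof
  assume disj: "set xs \<inter> set ys = {}"
  have "hd xs \<in> pverts G" "hd ys \<in> pverts G"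
    using assms by (auto simp: longest_def simple_path_def)
  then obtain zs where zs: "simple_path zs" "hd zs = hd xs" "last zs = hd ys"
    by (rule simple_path_exists)
  \<comment> \<open>Cut the connecting path \<open>zs\<close> at its first vertex \<open>q\<close>
    on \<open>ys\<close>, then at the last vertex \<open>p\<close> on \<open>xs\<close> before that;
    the part \<open>M\<close> in between avoids both paths.\<close>
  have ne: "zs \<noteq> []" "xs \<noteq> []" "ys \<noteq> []"
    using zs P Q by (auto simp: longest_def simple_path_def)
  have "\<exists>x\<in>set zs. x \<in> set ys" using zs ne by (metis hd_in_set last_in_set)
  then obtain zs1 q zs2 where z: "zs = zs1 @ q # zs2" "q \<in> set ys" "\<forall>x\<in>set zs1. x \<notin> set ys"
    using split_list_first_prop[of zs "\<lambda>x. x \<in> set ys"] by blast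
  have "hd zs \<notin> set ys" using zs(2) hd_in_set[OF ne(2)] disj by auto
  with z have "zs1 \<noteq> []" by auto
  then have "hd zs1 = hd xs" using z zs by simp
  with \<open>zs1 \<noteq> []\<close> ne have "\<exists>x\<in>set zs1. x \<in> set xs" by (metis hd_in_set)
  then obtain zs3 p M where z1: "zs1 = zs3 @ p # M" "p \<in> set xs" "\<forall>x\<in>set M. x \<notin> set xs"
    using split_list_last_prop[of zs1 "\<lambda>x. x \<in> set xs"] by blast
  have mid: "simple_path (p # M @ [q])"
    using simple_path_infix[of zs3 "p # M @ [q]" zs2] zs(1) unfolding z z1 by simp
  \<comment> \<open>The two pieces of the path ending at \<open>p\<close> both contain
    \<open>p\<close>, so they have \<open>longest_path_length G + 2\<close> vertices together and
    the longer one has at least half.\<close>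
  have half: "\<exists>T. 2 * length T \<ge> longest_path_length G + 2 \<and> simple_path T \<and> last T = p \<and> set T \<subseteq> set xs"
    if "longest xs" "p \<in> set xs" for xs p
  proof -
    obtain A B where xs: "xs = A @ p # B" using \<open>p \<in> set xs\<close> by (auto simp: in_set_conv_decomp)
    have len: "length A + length B = longest_path_length G" and sp: "simple_path xs"
      using \<open>longest xs\<close> by (auto simp: longest_def xs)
    have "simple_path (A @ [p])" "simple_path (p # B)"
      using sp simple_path_infix[of "[]" "A @ [p]" B] simple_path_infix[of A "p # B" "[]"]
      unfolding xs by simp_all
    then have "simple_path (A @ [p])" "simple_path (rev (p # B))"
      unfolding simple_path_rev by auto
    moreover have "length A \<ge> length B \<or> length B \<ge> length A" by linarith
    ultimately show ?thesis
    proof (elim disjE)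
      assume "length B \<le> length A"
      with \<open>simple_path (A @ [p])\<close> len xs show ?thesis by (intro exI[of _ "A @ [p]"]) auto
    next
      assume "length A \<le> length B"
      with \<open>simple_path (rev (p # B))\<close> len xs show ?thesis by (intro exI[of _ "rev (p # B)"]) auto
    qed
  qed
  obtain S where S: "2 * length S \<ge> longest_path_length G + 2" "simple_path S" "last S = p"
    "set S \<subseteq> set xs" using half[OF P z1(2)] by blast
  obtain T where T: "2 * length T \<ge> longest_path_length G + 2" "simple_path T" "last T = q"
    "set T \<subseteq> set ys" using half[OF Q z(2)] by blast
  have "S \<noteq> []" "T \<noteq> []" using S(2) T(2) by (auto simp: simple_path_def)
  then obtain S' T' where [simp]: "S = S' @ [p]" "T = T' @ [q]"
    using S(3) T(3) by (metis append_butlast_last_id)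
  have "simple_path (rev T)" using T(2) unfolding simple_path_rev .
  moreover have "set M \<inter> set xs = {}" "set M \<inter> set ys = {}" using z z1 by auto
  ultimately have "simple_path (S' @ p # M @ q # rev T')"
    using S T mid disj by (intro simple_path_splice) auto
  from length_le_longest[OF this] show False using S T by simp
qed

section \<open>Where one longest path meets another\<close>

text \<open>By \<open>longest_inter\<close> there is a first vertex on \<open>ys\<close>; its index
  is the length of the tail before it, which \<open>longest_tail\<close> bounds.\<close>

lemma longest_hits_first_half:
  assumes "longest xs" "longest ys"
  obtains i where "i < length xs" "i \<le> longest_path_length G div 2" "xs ! i \<in> set ys"
proof -
  have "\<exists>x\<in>set xs. x \<in> set ys" using longest_inter[OF assms] by blast
  then obtain T q B where xs: "xs = T @ q # B" "q \<in> set ys" "\<forall>x\<in>set T. x \<notin> set ys"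
    using split_list_first_prop[of xs "\<lambda>x. x \<in> set ys"] by blast
  then have "2 * length T \<le> longest_path_length G"
    using longest_tail[of T q B ys] assms by auto
  then show thesis using xs by (intro that[of "length T"]) auto
qed

lemma longest_hits_second_half:
  assumes "longest xs" "longest ys"
  obtains i where "i < length xs" "longest_path_length G div 2 \<le> i" "xs ! i \<in> set ys"
proof -
  have "longest (rev xs)" using assms(1) by simp
  then obtain i where i: "i < length (rev xs)" "i \<le> longest_path_length G div 2" "rev xs ! i \<in> set ys"
    using longest_hits_first_half assms(2) by blast
  have "length xs = longest_path_length G + 1" using assms(1) by (simp add: longest_def)
  \<comment> \<open>Reversal sends index \<open>i\<close> to
    \<open>longest_path_length G - i\<close>; since \<open>div\<close> rounds down, this is still at
    least \<open>longest_path_length G div 2\<close>.\<close>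
  then show thesis using i
    by (intro that[of "longest_path_length G - i"]) (auto simp: rev_nth)
qed

text \<open>Write \<open>ys\<close> as \<open>A @ p # H @ q # C\<close>. Using \<open>M\<close> as a
  detour in place of \<open>H\<close>, of \<open>C\<close> or of \<open>A\<close> (in the last two
  cases with \<open>H\<close> reversed) gives three paths, so \<open>M\<close> is no longer than any
  of the three pieces.\<close>

lemma longest_gap:
  assumes P: "longest (S @ p # M @ q # T)" and Q: "longest ys" "p \<in> set ys" "q \<in> set ys"
    and M: "set M \<inter> set ys = {}"
  shows "3 * (length M + 1) \<le> longest_path_length G + 2"
proof (cases "M = []")
  case True
  then show ?thesis using P by (simp add: longest_def)
next
  case False
  define n where "n = longest_path_length G"
  have "simple_path (S @ (p # M @ [q]) @ T)" using P by (simp add: longest_def)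
  then have mid: "simple_path (p # M @ [q])" "p \<noteq> q"
    using simple_path_infix[of S "p # M @ [q]" T] by (auto simp: simple_path_def)
  \<comment> \<open>Stated for fresh \<open>p\<close>, \<open>q\<close>, \<open>M\<close>, because
    \<open>ys\<close> may visit \<open>q\<close> first; then it is applied to \<open>rev M\<close>
    with the ends exchanged.\<close>
  have *: "3 * (length M + 1) \<le> n + 2"
    if p: "simple_path (p # M @ [q])" and Q: "longest (A @ p # H @ q # C)" and
       M: "set M \<inter> set (A @ p # H @ q # C) = {}" for p q M A H C
  proof -
    have A: "simple_path (A @ p # H @ q # C)" using Q by (simp add: longest_def)
    then have "simple_path (A @ [p])" "simple_path (q # C)" "simple_path (p # H)" "simple_path (H @ [q])"
      and dist: "distinct (A @ p # H @ q # C)"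
      using simple_path_infix[of "[]" "A @ [p]" "H @ q # C"]
        simple_path_infix[of "A @ p # H" "q # C" "[]"] simple_path_infix[of A "p # H" "q # C"]
        simple_path_infix[of "A @ [p]" "H @ [q]" C]
      by (simp_all add: simple_path_def)
    moreover from this have "simple_path (rev H @ [p])" "simple_path (q # rev H)"
      using simple_path_rev[of "p # H"] simple_path_rev[of "H @ [q]"] by simp_all
    ultimately have 1: "simple_path (A @ p # M @ q # C)" "simple_path (A @ p # M @ q # rev H)"
      "simple_path (rev H @ p # M @ q # C)"
      using p M dist by (intro simple_path_splice; auto; fail)+
    show ?thesis
      using 1[THEN length_le_longest] Q by (simp add: longest_def n_def)
  qed
  obtain A D where ys: "ys = A @ p # D" using Q(2) by (auto simp: in_set_conv_decomp)
  consider "q \<in> set D" | "q \<in> set A" using Q(3) mid(2) ys by auto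
  then have "3 * (length M + 1) \<le> n + 2"
  proof cases
    case 1
    then obtain H C where "D = H @ q # C" by (auto simp: in_set_conv_decomp)
    then show ?thesis using *[of p M q A H C] mid Q(1) M ys by simp
  next
    case 2
    then obtain C H where "A = C @ q # H" by (auto simp: in_set_conv_decomp)
    then show ?thesis using *[of q "rev M" p C H D] simple_path_rev[of "p # M @ [q]"] mid Q(1) M ys
      by simp
  qed
  then show ?thesis by (simp add: n_def)
qed

text \<open>If \<open>v\<close> is off \<open>ys\<close>, it lies in a gap \<open>M @ v # N\<close>
  whose ends are on \<open>ys\<close>. The nearer end is within half of
  \<open>length M + length N + 2\<close>, and \<open>longest_gap\<close> bounds this sum by a third
  of \<open>longest_path_length G + 2\<close>.\<close>

lemma graph_dist_set_in_gap:
  assumes P: "longest (X @ v # Y)" and Q: "longest ys"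
    and X: "set X \<inter> set ys \<noteq> {}" and Y: "set Y \<inter> set ys \<noteq> {}"
  shows "graph_dist_set G v (set ys) \<le> (longest_path_length G + 2) div 6"
proof (cases "v \<in> set ys")
  case True
  then show ?thesis using graph_dist_set_eq_0[of v "set ys"] P
    by (auto simp: longest_def simple_path_def)
next
  case False
  obtain S p M where S: "X = S @ p # M" "p \<in> set ys" "\<forall>x\<in>set M. x \<notin> set ys"
    using X split_list_last_prop[of X "\<lambda>x. x \<in> set ys"] by blast
  obtain N q T where T: "Y = N @ q # T" "q \<in> set ys" "\<forall>x\<in>set N. x \<notin> set ys"
    using Y split_list_first_prop[of Y "\<lambda>x. x \<in> set ys"] by blast
  have "simple_path (S @ (p # M @ [v]) @ N @ q # T)" "simple_path ((S @ p # M) @ (v # N @ [q]) @ T)"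
    using P unfolding S T by (simp_all add: longest_def)
  then have "simple_path (p # M @ [v])" and right: "simple_path (v # N @ [q])"
    by (metis simple_path_infix list.distinct(1))+
  then have left: "simple_path (v # rev M @ [p])"
    using simple_path_rev[of "p # M @ [v]"] by simp
  have "graph_dist_set G v (set ys) \<le> length M + 1"
    using graph_dist_set_less_length[OF left, of "set ys"] S(2) by simp
  moreover have "graph_dist_set G v (set ys) \<le> length N + 1"
    using graph_dist_set_less_length[OF right, of "set ys"] T(2) by simp
  moreover have "3 * (length (M @ v # N) + 1) \<le> longest_path_length G + 2"
    by (rule longest_gap[of S p _ q T ys]) (use P Q S T False in auto)
  ultimately show ?thesis by simp
qed

section \<open>A vertex with small distance sum\<close>

lemma exists_central_vertex:
  assumes Ps: "Ps \<subseteq> longest_paths G" and "card Ps \<ge> 2"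
  obtains v where "v \<in> pverts G"
    "(\<Sum>P\<in>Ps. graph_dist_set G v (pverts P)) \<le> (card Ps - 2) * ((longest_path_length G + 2) div 6)"
proof -
  define c where "c = longest_path_length G div 2"
  have fin: "finite Ps" using \<open>card Ps \<ge> 2\<close> by (intro card_ge_0_finite) simp
  obtain P where P: "P \<in> Ps" using \<open>card Ps \<ge> 2\<close> by fastforce
  then obtain xs where xs: "longest xs" "set xs = pverts P"
    using Ps longest_pathsE by blast
  \<comment> \<open>Starting at the middle \<open>c\<close> keeps every first-half hit at or before
    \<open>i\<close>; \<open>P\<close> is excluded because each vertex of \<open>xs\<close> lies on
    it.\<close>
  define hit where "hit i \<longleftrightarrow> c \<le> i \<and> i < length xs \<and> (\<exists>Q\<in>Ps - {P}. xs ! i \<in> pverts Q)" for i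
  define i where "i = (LEAST i. hit i)"
  have ex: "\<exists>j. c \<le> j \<and> j < length xs \<and> xs ! j \<in> pverts Q" if "Q \<in> Ps" for Q
    using that Ps xs(1) longest_hits_second_half unfolding c_def by (metis longest_pathsE subsetD)
  have "card (Ps - {P}) > 0" using fin P \<open>card Ps \<ge> 2\<close> by simp
  then obtain Q where "Q \<in> Ps - {P}" by (auto simp: card_gt_0_iff)
  then have "\<exists>i. hit i" using ex[of Q] by (auto simp: hit_def)
  then have "hit i" unfolding i_def by (rule LeastI_ex)
  then obtain Q where i: "c \<le> i" "i < length xs" and Q: "Q \<in> Ps" "Q \<noteq> P" "xs ! i \<in> pverts Q"
    by (auto simp: hit_def)
  have v: "xs ! i \<in> pverts G" "xs ! i \<in> pverts P"
    using i xs by (auto simp: longest_def simple_path_def)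
  have finP: "finite (pverts R)" if "R \<in> Ps" for R
    using that Ps by (metis longest_pathsE List.finite_set subsetD)
  have "graph_dist_set G (xs ! i) (pverts R) \<le> (longest_path_length G + 2) div 6"
    if R: "R \<in> Ps - {P, Q}" for R
  proof (cases "xs ! i \<in> pverts R")
    case True
    then show ?thesis using graph_dist_set_eq_0 v finP R by simp
  next
    case False
    obtain ys where ys: "longest ys" "set ys = pverts R"
      using R Ps longest_pathsE by blast
    obtain l where l: "l < length xs" "l \<le> c" "xs ! l \<in> set ys"
      using longest_hits_first_half[OF xs(1) ys(1)] c_def by blast
    obtain r where r: "c \<le> r" "r < length xs" "xs ! r \<in> pverts R"
      using ex[of R] R by blast
    \<comment> \<open>Minimality of \<open>i\<close> puts \<open>r\<close> at or beyond it, while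
      \<open>l\<close> is at most \<open>c\<close>. As \<open>R\<close> misses
      \<open>xs ! i\<close>, both comparisons are strict and \<open>xs ! i\<close> lies between two
      vertices of \<open>R\<close>.\<close>
    then have "hit r" using R by (auto simp: hit_def)
    then have "i \<le> r" unfolding i_def by (rule Least_le)
    moreover have "i \<noteq> r" "l \<noteq> i" using r False l ys by auto
    ultimately have lr: "l < i" "i < r" using l i by auto
    have split: "longest (take i xs @ xs ! i # drop (Suc i) xs)"
      using xs(1) id_take_nth_drop[OF i(2)] by simp
    have "take i xs ! l = xs ! l" "l < length (take i xs)"
      using lr l by simp_all
    then have "xs ! l \<in> set (take i xs)" by (metis nth_mem)
    moreover have "drop (Suc i) xs ! (r - Suc i) = xs ! r" "r - Suc i < length (drop (Suc i) xs)"
      using lr r by simp_all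
    then have "xs ! r \<in> set (drop (Suc i) xs)" by (metis nth_mem)
    ultimately have "set (take i xs) \<inter> set ys \<noteq> {}" "set (drop (Suc i) xs) \<inter> set ys \<noteq> {}"
      using l(3) r(3) ys(2) by blast+
    from graph_dist_set_in_gap[OF split ys(1) this] show ?thesis using ys(2) by simp
  qed
  then have "(\<Sum>R\<in>Ps - {P, Q}. graph_dist_set G (xs ! i) (pverts R))
      \<le> card (Ps - {P, Q}) * ((longest_path_length G + 2) div 6)"
    using sum_bounded_above[of "Ps - {P, Q}" "\<lambda>R. graph_dist_set G (xs ! i) (pverts R)"
      "(longest_path_length G + 2) div 6"] by simp
  moreover have "card (Ps - {P, Q}) = card Ps - 2"
    using P Q by (simp add: card_Diff_subset)
  \<comment> \<open>Both \<open>P\<close> and \<open>Q\<close> contain \<open>xs ! i\<close> and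
    contribute 0, which saves two summands.\<close>
  moreover have "(\<Sum>R\<in>Ps. graph_dist_set G (xs ! i) (pverts R))
      = (\<Sum>R\<in>Ps - {P, Q}. graph_dist_set G (xs ! i) (pverts R))"
    using fin P Q v finP graph_dist_set_eq_0 by (intro sum.mono_neutral_right) auto
  ultimately show thesis using that[OF v(1)] by simp
qed

section \<open>Counting and averaging over all vertices\<close>

lemma path_distance_le:
  assumes "v \<in> pverts G"
  shows "path_distance G Ps \<le> (\<Sum>P\<in>Ps. graph_dist_set G v (pverts P))"
proof -
  have "{\<Sum>P\<in>Ps. graph_dist_set G v (pverts P) | v. v \<in> pverts G}
      = (\<lambda>v. \<Sum>P\<in>Ps. graph_dist_set G v (pverts P)) ` pverts G"
    by auto
  then show ?thesis
    unfolding path_distance_def using assms pair_finite_verts by (intro Min_le) auto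
qed

lemma longest_paths_card:
  assumes "P \<in> longest_paths G"
  shows "card (pverts P) = longest_path_length G + 1" "pverts P \<subseteq> pverts G" "finite (pverts P)"
    "pverts P \<noteq> {}"
proof -
  obtain xs where "longest xs" "set xs = pverts P"
    using longest_pathsE[OF assms] .
  then show "card (pverts P) = longest_path_length G + 1" "pverts P \<subseteq> pverts G"
    "finite (pverts P)" "pverts P \<noteq> {}"
    using assms List.finite_set[of xs]
    by (auto simp: longest_paths_def longest_def simple_path_def simp del: List.finite_set)
qed

text \<open>Double counting of the pairs of a path in \<open>Ps\<close> and a vertex on it: a vertex
  on all paths would have distance sum 0.\<close>

lemma card_mult_longest_le:
  assumes Ps: "Ps \<subseteq> longest_paths G" "finite Ps" and "path_distance G Ps > 0"
  shows "card Ps * (longest_path_length G + 1) \<le> (card Ps - 1) * card (pverts G)"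
proof -
  have le: "card {P \<in> Ps. v \<in> pverts P} \<le> card Ps - 1" if v: "v \<in> pverts G" for v
  proof -
    have "{P \<in> Ps. v \<in> pverts P} \<noteq> Ps"
    proof
      assume "{P \<in> Ps. v \<in> pverts P} = Ps"
      then have "graph_dist_set G v (pverts P) = 0" if "P \<in> Ps" for P
        using that v Ps longest_paths_card(3) by (intro graph_dist_set_eq_0) auto
      then show False using path_distance_le[OF v, of Ps] \<open>path_distance G Ps > 0\<close> by simp
    qed
    then have "card {P \<in> Ps. v \<in> pverts P} < card Ps"
      using Ps(2) by (intro psubset_card_mono) auto
    then show ?thesis by simp
  qed
  have "card Ps * (longest_path_length G + 1) = (\<Sum>P\<in>Ps. card {v \<in> pverts G. v \<in> pverts P})"
  proof -
    have "card {v \<in> pverts G. v \<in> pverts P} = longest_path_length G + 1" if "P \<in> Ps" for P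
    proof -
      have "{v \<in> pverts G. v \<in> pverts P} = pverts P" using that Ps longest_paths_card(2) by blast
      then show ?thesis using that Ps longest_paths_card(1) by auto
    qed
    then show ?thesis by simp
  qed
  also have "\<dots> = (\<Sum>v\<in>pverts G. card {P \<in> Ps. v \<in> pverts P})"
    using sum.swap_restrict[OF Ps(2) pair_finite_verts, of "\<lambda>_ _. 1::nat" "\<lambda>P v. v \<in> pverts P"] by simp
  also have "\<dots> \<le> (card Ps - 1) * card (pverts G)"
    using sum_bounded_above[of "pverts G" "\<lambda>v. card {P \<in> Ps. v \<in> pverts P}" "card Ps - 1"] le
    by (simp add: mult.commute)
  finally show ?thesis .
qed

lemma path_to_set:
  assumes "v \<in> pverts G" "U \<subseteq> pverts G" "U \<noteq> {}"
  obtains xs q where "simple_path (xs @ [q])" "hd (xs @ [q]) = v" "q \<in> U" "set xs \<subseteq> pverts G - U"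
proof -
  obtain u where u: "u \<in> U" using assms(3) by blast
  then obtain zs where zs: "simple_path zs" "hd zs = v" "last zs = u"
    using simple_path_exists[of v u] assms by blast
  then have "zs \<noteq> []" by (simp add: simple_path_def)
  then have "\<exists>x\<in>set zs. x \<in> U" using zs u last_in_set by blast
  then obtain xs q ys where z: "zs = xs @ q # ys" "q \<in> U" "\<forall>x\<in>set xs. x \<notin> U"
    using split_list_first_prop[of zs "\<lambda>x. x \<in> U"] by blast
  have sp: "simple_path (xs @ [q])"
    using simple_path_infix[of "[]" "xs @ [q]" ys] zs(1) z(1) by simp
  moreover have "hd (xs @ [q]) = v" using zs(2) z(1) by (cases xs) auto
  ultimately show thesis using z by (intro that[of xs q]) (auto simp: simple_path_def)
qed

text \<open>A path stopped at its first vertex in \<open>U\<close> has all its other vertices, which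
  are distinct, outside \<open>U\<close>.\<close>

lemma graph_dist_set_le_card:
  assumes "v \<in> pverts G" "U \<subseteq> pverts G" "U \<noteq> {}"
  shows "graph_dist_set G v U \<le> card (pverts G - U)"
proof -
  obtain xs q where xs: "simple_path (xs @ [q])" "hd (xs @ [q]) = v" "q \<in> U" "set xs \<subseteq> pverts G - U"
    using path_to_set[OF assms] .
  have "graph_dist_set G v U < length (xs @ [q])"
    using graph_dist_set_less_length[OF xs(1), of U] xs finite_subset[OF assms(2) pair_finite_verts]
    by simp
  moreover have "length xs = card (set xs)" using xs(1) by (simp add: simple_path_def distinct_card)
  moreover have "card (set xs) \<le> card (pverts G - U)"
    using xs(4) pair_finite_verts by (intro card_mono) auto
  ultimately show ?thesis by simp
qed

text \<open>The last vertex before a path first enters \<open>U\<close> is adjacent to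
  \<open>U\<close>.\<close>

lemma graph_dist_set_le_1:
  assumes "U \<subset> pverts G" "U \<noteq> {}"
  obtains w where "w \<in> pverts G - U" "graph_dist_set G w U \<le> 1"
proof -
  obtain v where v: "v \<in> pverts G" "v \<notin> U" using assms(1) by blast
  obtain xs q where xs: "simple_path (xs @ [q])" "hd (xs @ [q]) = v" "q \<in> U" "set xs \<subseteq> pverts G - U"
    using path_to_set[of v U] v assms by blast
  have "xs \<noteq> []" using xs v by auto
  then have "xs @ [q] = butlast xs @ [last xs, q] @ []" by simp
  then have "simple_path (butlast xs @ [last xs, q] @ [])" using xs(1) by (simp only:)
  then have "simple_path [last xs, q]" by (rule simple_path_infix) simp
  moreover have "finite U" using assms(1) pair_finite_verts by (meson finite_subset psubset_imp_subset)
  ultimately have "graph_dist_set G (last xs) U \<le> 1"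
    using graph_dist_set_less_length[of "[last xs, q]" U] xs(3) by simp
  then show thesis using that[of "last xs"] \<open>xs \<noteq> []\<close> xs(4) last_in_set by blast
qed

text \<open>One outside vertex contributes at most 1, each of the other \<open>x - 1\<close> at most
  \<open>x\<close>. The bound is applied in earnest only for \<open>x = 1\<close> and
  \<open>x = 2\<close>, where it is 1 and 3.\<close>

lemma sum_graph_dist_set_le:
  assumes "U \<subset> pverts G" "U \<noteq> {}"
  defines "x \<equiv> card (pverts G - U)"
  shows "(\<Sum>v\<in>pverts G. graph_dist_set G v U) \<le> 1 + (x - 1) * x"
proof -
  obtain w where w: "w \<in> pverts G - U" "graph_dist_set G w U \<le> 1"
    using graph_dist_set_le_1[OF assms(1,2)] .
  have "finite U" using assms(1) pair_finite_verts by (meson finite_subset psubset_imp_subset)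
  then have "(\<Sum>v\<in>pverts G. graph_dist_set G v U) = (\<Sum>v\<in>pverts G - U. graph_dist_set G v U)"
    using pair_finite_verts graph_dist_set_eq_0 by (intro sum.mono_neutral_right) auto
  also have "\<dots> = graph_dist_set G w U + (\<Sum>v\<in>pverts G - U - {w}. graph_dist_set G v U)"
    using w pair_finite_verts by (intro sum.remove) auto
  also have "(\<Sum>v\<in>pverts G - U - {w}. graph_dist_set G v U) \<le> card (pverts G - U - {w}) * x"
    using sum_bounded_above[of "pverts G - U - {w}" "\<lambda>v. graph_dist_set G v U" x]
      graph_dist_set_le_card[of _ U] assms by auto
  also have "card (pverts G - U - {w}) = x - 1"
    using w pair_finite_verts by (simp add: x_def)
  finally show ?thesis using w(2) by simp
qed

text \<open>The minimum is at most the average; exchanging the sums lets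
  \<open>sum_graph_dist_set_le\<close> bound the share of each path.\<close>

lemma card_mult_path_distance_le:
  assumes Ps: "Ps \<subseteq> longest_paths G" and "longest_path_length G + 1 < card (pverts G)"
  defines "x \<equiv> card (pverts G) - (longest_path_length G + 1)"
  shows "card (pverts G) * path_distance G Ps \<le> card Ps * (1 + (x - 1) * x)"
proof -
  have "(\<Sum>v\<in>pverts G. graph_dist_set G v (pverts P)) \<le> 1 + (x - 1) * x" if "P \<in> Ps" for P
  proof -
    have P: "P \<in> longest_paths G" using that Ps by blast
    have "card (pverts G - pverts P) = x"
      using longest_paths_card[OF P] by (simp add: card_Diff_subset x_def)
    moreover have "pverts P \<noteq> pverts G" using longest_paths_card(1)[OF P] assms(2) by auto
    ultimately show ?thesis
      using sum_graph_dist_set_le[of "pverts P"] longest_paths_card[OF P] by auto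
  qed
  then have "(\<Sum>P\<in>Ps. \<Sum>v\<in>pverts G. graph_dist_set G v (pverts P)) \<le> card Ps * (1 + (x - 1) * x)"
    using sum_bounded_above[of Ps "\<lambda>P. \<Sum>v\<in>pverts G. graph_dist_set G v (pverts P)"
      "1 + (x - 1) * x"] by simp
  moreover have "card (pverts G) * path_distance G Ps
      \<le> (\<Sum>v\<in>pverts G. \<Sum>P\<in>Ps. graph_dist_set G v (pverts P))"
    using sum_bounded_below[of "pverts G" "path_distance G Ps"
      "\<lambda>v. \<Sum>P\<in>Ps. graph_dist_set G v (pverts P)"] path_distance_le by simp
  ultimately show ?thesis by (simp add: sum.swap[of _ Ps])
qed

end

section \<open>Combining the inequalities\<close>

text \<open>Here \<open>L\<close> and \<open>n\<close> count the vertices of a longest path and of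
  the graph. Integers avoid truncated subtraction, and both sides factor, as \<open>lhs\<close> and
  \<open>rhs\<close> show.\<close>

lemma ratio_arith:
  fixes f k L n :: int
  assumes k: "k \<ge> 3" and f: "f \<ge> 1" and L: "L \<ge> 5"
    and central: "6 * f \<le> (k - 2) * (L + 1)"
    and cover: "k * L \<le> (k - 1) * n"
    and average: "L < n \<Longrightarrow> n * f \<le> k * (1 + (n - L - 1) * (n - L))"
  shows "f * (6 * k^2 - 8 * k) \<le> (k^3 - 4 * k^2 + 5 * k - 2) * n"
proof -
  have lhs: "f * (6 * k^2 - 8 * k) = 2 * k * (3 * k - 4) * f"
    and rhs: "(k^3 - 4 * k^2 + 5 * k - 2) * n = (k - 1)^2 * (k - 2) * n"
    by (simp_all add: power2_eq_square power3_eq_cube algebra_simps)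
  have "3 * (2 * k * (3 * k - 4) * f) = k * (3 * k - 4) * (6 * f)" by simp
  also have "\<dots> \<le> k * (3 * k - 4) * ((k - 2) * (L + 1))"
    using central k by (intro mult_left_mono) auto
  finally have *: "3 * (2 * k * (3 * k - 4) * f) \<le> k * (3 * k - 4) * ((k - 2) * (L + 1))" .
  consider "L \<ge> 3 * k - 4" | "L \<le> 3 * k - 5" "n \<ge> L + 3" | "L \<le> 3 * k - 5" "n \<le> L + 2"
    by linarith
  then have "2 * k * (3 * k - 4) * f \<le> (k - 1)^2 * (k - 2) * n"
  proof cases
    case 1
    have "k * (3 * k - 4) * ((k - 2) * (L + 1)) = k * (k - 2) * ((3 * k - 4) * (L + 1))" by simp
    \<comment> \<open>This is equivalent to \<open>L \<ge> 3 * k - 4\<close>, which explains the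
      threshold.\<close>
    also have "(3 * k - 4) * (L + 1) \<le> (3 * k - 3) * L" using 1 by (simp add: algebra_simps)
    then have "k * (k - 2) * ((3 * k - 4) * (L + 1)) \<le> k * (k - 2) * ((3 * k - 3) * L)"
      using k by (intro mult_left_mono) auto
    also have "\<dots> = 3 * (k - 1) * (k - 2) * (k * L)" by (simp add: algebra_simps)
    also have "\<dots> \<le> 3 * (k - 1) * (k - 2) * ((k - 1) * n)"
      using cover k by (intro mult_left_mono) auto
    also have "\<dots> = 3 * ((k - 1)^2 * (k - 2) * n)" by (simp add: power2_eq_square)
    finally show ?thesis using * by linarith
  next
    case 2
    \<comment> \<open>In the next inequality, right side minus left side has slope
      \<open>-(2 * k - 3)\<close> in \<open>L\<close>, so the worst case is
      \<open>L = 3 * k - 5\<close>.\<close>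
    have "L * (2 * k - 3) \<le> (3 * k - 5) * (2 * k - 3)"
      using 2 k by (intro mult_right_mono) auto
    then have "k * (3 * k - 4) * (L + 1) \<le> 3 * (k - 1)^2 * (L + 3)"
      using k by (simp add: power2_eq_square algebra_simps)
    also have "\<dots> \<le> 3 * (k - 1)^2 * n" using 2 by (intro mult_left_mono) auto
    finally have "(k - 2) * (k * (3 * k - 4) * (L + 1)) \<le> (k - 2) * (3 * (k - 1)^2 * n)"
      using k by (intro mult_left_mono) auto
    moreover have "(k - 2) * (k * (3 * k - 4) * (L + 1)) = k * (3 * k - 4) * ((k - 2) * (L + 1))"
      "(k - 2) * (3 * (k - 1)^2 * n) = 3 * ((k - 1)^2 * (k - 2) * n)"
      by simp_all
    ultimately show ?thesis using * by linarith
  next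
    case 3
    have "L < n"
    proof (rule ccontr)
      assume "\<not> L < n"
      then have "(k - 1) * n \<le> (k - 1) * L" using k by (intro mult_left_mono) auto
      then show False using cover L by (simp add: algebra_simps)
    qed
    \<comment> \<open>The bounds \<open>5 \<le> L \<le> 3 * k - 5\<close> force
      \<open>k \<ge> 4\<close>; shifting by 4 makes all coefficients of the final polynomial
      positive.\<close>
    obtain j where j: "k = j + 4" "j \<ge> 0" using 3 L by (intro that[of "k - 4"]) auto
    \<comment> \<open>The constant comes from \<open>n = L + 2\<close>: then
      \<open>n \<ge> 7\<close>, so \<open>7 * f \<le> 3 * k\<close> and
      \<open>7 * k \<le> k * n\<close>.\<close>
    have "49 * f \<le> 3 * (k * n)"
    proof (cases "n = L + 1")
      case True
      then have "6 * f \<le> n * f" "k * 6 \<le> k * n" "n * f \<le> k"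
        using L f k average[OF \<open>L < n\<close>] by (auto intro: mult_left_mono mult_right_mono)
      then show ?thesis using k by linarith
    next
      case False
      then have "n = L + 2" using 3 \<open>L < n\<close> by linarith
      then have "7 * f \<le> n * f" "k * 7 \<le> k * n" "n * f \<le> k * 3"
        using L f k average[OF \<open>L < n\<close>] by (auto intro: mult_left_mono mult_right_mono)
      then show ?thesis by linarith
    qed
    then have "2 * k * (3 * k - 4) * (49 * f) \<le> 2 * k * (3 * k - 4) * (3 * (k * n))"
      using k by (intro mult_left_mono) auto
    also have "\<dots> = (6 * k^2 * (3 * k - 4)) * n" by (simp add: power2_eq_square)
    also have "\<dots> \<le> (49 * ((k - 1)^2 * (k - 2))) * n"
    proof (rule mult_right_mono)
      have "49 * ((k - 1)^2 * (k - 2)) - 6 * k^2 * (3 * k - 4) = 31 * j^3 + 200 * j^2 + 357 * j + 114"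
        by (simp add: j(1) power2_eq_square power3_eq_cube algebra_simps)
      moreover have "31 * j^3 + 200 * j^2 + 357 * j + 114 \<ge> 0" using j(2) by simp
      ultimately show "6 * k^2 * (3 * k - 4) \<le> 49 * ((k - 1)^2 * (k - 2))" by linarith
    qed (use L \<open>L < n\<close> in simp)
    finally have "2 * k * (3 * k - 4) * (49 * f) \<le> 49 * ((k - 1)^2 * (k - 2)) * n" .
    moreover have "2 * k * (3 * k - 4) * (49 * f) = 49 * (2 * k * (3 * k - 4) * f)"
      "49 * ((k - 1)^2 * (k - 2)) * n = 49 * ((k - 1)^2 * (k - 2) * n)"
      by simp_all
    ultimately show ?thesis by linarith
  qed
  then show ?thesis by (simp only: lhs rhs)
qed

section \<open>Bounding each ratio and hence the supremum\<close>

theorem theorem4: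
  fixes k :: nat
  assumes "k \<ge> 3"
  shows "path_distance_ratio k (connected_graphs :: 'a pair_pre_digraph set)
    \<le> ereal ((real k ^ 3 - 4 * real k ^ 2 + 5 * real k - 2) / (6 * real k ^ 2 - 8 * real k))"
proof -
  have "real (path_distance G Ps) / real (card (pverts G))
      \<le> (real k ^ 3 - 4 * real k ^ 2 + 5 * real k - 2) / (6 * real k ^ 2 - 8 * real k)"
    if G: "G \<in> connected_graphs" and Ps: "Ps \<subseteq> longest_paths G" "card Ps = k"
    for G :: "'a pair_pre_digraph" and Ps
  proof -
    interpret connected_pair_graph G
      using G by (simp add: connected_graphs_def connected_pair_graph_def connected_pair_graph_axioms_def)
    define f where "f = path_distance G Ps"
    define L where "L = longest_path_length G + 1"
    define n where "n = card (pverts G)"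
    have "finite Ps" using Ps(2) assms by (intro card_ge_0_finite) simp
    have "Ps \<noteq> {}" using Ps(2) assms by auto
    then obtain P where "P \<in> longest_paths G" using Ps(1) by blast
    then have "pverts G \<noteq> {}" using longest_paths_card(2,4) by fastforce
    then have n: "n > 0" using pair_finite_verts by (simp add: n_def card_gt_0_iff)
    have den: "6 * real k ^ 2 - 8 * real k > 0"
    proof -
      have "6 * real k ^ 2 - 8 * real k = 2 * real k * (3 * real k - 4)"
        by (simp add: power2_eq_square algebra_simps)
      then show ?thesis using assms by simp
    qed
    \<comment> \<open>The ratio bound with denominators cleared, moved to the integers for
      \<open>ratio_arith\<close>.\<close>
    have "int f * (6 * int k ^ 2 - 8 * int k) \<le> (int k ^ 3 - 4 * int k ^ 2 + 5 * int k - 2) * int n"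
    proof (cases "f = 0")
      case True
      have "int k ^ 3 - 4 * int k ^ 2 + 5 * int k - 2 = (int k - 1)^2 * (int k - 2)"
        by (simp add: power2_eq_square power3_eq_cube algebra_simps)
      then show ?thesis using True assms by simp
    next
      case False
      obtain v where "v \<in> pverts G"
        "(\<Sum>P\<in>Ps. graph_dist_set G v (pverts P)) \<le> (k - 2) * ((longest_path_length G + 2) div 6)"
        using exists_central_vertex[OF Ps(1)] Ps(2) assms by auto
      then have f: "f \<le> (k - 2) * ((L + 1) div 6)"
        using path_distance_le[of v Ps] by (simp add: f_def L_def)
      \<comment> \<open>The rounded quotient matters: a positive \<open>f\<close> forces it to be at
        least 1, hence \<open>L \<ge> 5\<close>.\<close>
      then have "(L + 1) div 6 > 0" using False by (auto intro: Nat.gr0I)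
      then have L: "L \<ge> 5" by (simp add: div_greater_zero_iff)
      have "6 * f \<le> (k - 2) * (6 * ((L + 1) div 6))" using f by simp
      also have "\<dots> \<le> (k - 2) * (L + 1)" by (intro mult_left_mono) auto
      finally have "int (6 * f) \<le> int ((k - 2) * (L + 1))"
        by (simp only: of_nat_le_iff)
      moreover have "2 \<le> k" using assms by simp
      ultimately have central: "6 * int f \<le> (int k - 2) * (int L + 1)"
        by (simp only: of_nat_mult of_nat_add of_nat_1 of_nat_numeral of_nat_diff[of 2])
      have "k * L \<le> (k - 1) * n"
        using card_mult_longest_le[OF Ps(1) \<open>finite Ps\<close>] False Ps(2) by (simp add: f_def L_def n_def)
      then have "int (k * L) \<le> int ((k - 1) * n)"
        by (simp only: of_nat_le_iff)
      then have cover: "int k * int L \<le> (int k - 1) * int n"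
        using assms by (simp add: of_nat_diff)
      have average: "int n * int f \<le> int k * (1 + (int n - int L - 1) * (int n - int L))" if "int L < int n"
      proof -
        have "n * f \<le> k * (1 + (n - L - 1) * (n - L))"
          using card_mult_path_distance_le[OF Ps(1)] that Ps(2) by (simp add: f_def L_def n_def)
        then have "int (n * f) \<le> int (k * (1 + (n - L - 1) * (n - L)))"
          by (simp only: of_nat_le_iff)
        moreover have "L \<le> n" "1 \<le> n - L" using that by simp_all
        ultimately show ?thesis
          by (simp only: of_nat_mult of_nat_add of_nat_1 of_nat_diff)
      qed
      show ?thesis
        by (rule ratio_arith) (use assms False L central cover average in auto)
    qed
    then have "real_of_int (int f * (6 * int k ^ 2 - 8 * int k))
        \<le> real_of_int ((int k ^ 3 - 4 * int k ^ 2 + 5 * int k - 2) * int n)"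
      by (rule of_int_le_iff[THEN iffD2])
    then have "real f * (6 * real k ^ 2 - 8 * real k)
        \<le> (real k ^ 3 - 4 * real k ^ 2 + 5 * real k - 2) * real n"
      by simp
    then show ?thesis
      using n den by (simp add: f_def n_def pos_divide_le_eq pos_le_divide_eq mult_ac)
  qed
  then show ?thesis
    unfolding path_distance_ratio_def by (intro Sup_least) auto
qed

end
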